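(* Let $H_1$ and $H_2$ be two hypergraphs with disjoint vertex sets. Then the outcome $o(H_1\cup H_2)$ is determined by $o(H_1)$ and $o(H_2)$ as follows: \begin{itemize} \item if $o(H_1)=\mathcal{A}$ then $o(H_1\cup H_2)=o(H_2)$, and if $o(H_2)=\mathcal{A}$ then $o(H_1\cup H_2)=o(H_1)$; \item if $o(H_1)=o(H_2)=\mathcal{SL}$ then $o(H_1\cup H_2)=\mathcal{E}$; \item if $o(H_1)=\mathcal{E}$ or $o(H_2)=\mathcal{E}$ then $o(H_1\cup H_2)=\mathcal{E}$. \end{itemize}
   Context: A hypergraph $H$ has a finite vertex set $V(H)$ and an edge set $E(H)\subseteq 2^{V(H)}$ (the empty edge is allowed). In the Avoider-Enforcer game on $H$, two players, Avoider and Enforcer, alternately pick one previously unpicked vertex of $H$ until all vertices have been picked. Enforcer wins if at the end Avoider has picked all the vertices of some edge of $H$; otherwise Avoider wins (in particular Enforcer wins if $\varnothing\in E(H)$). The last player is the player who makes the last move of the game: this is the first player if $|V(H)|$ is odd and the second player if $|V(H)|$ is even; the other player is the second-to-last player. A player "wins on $H$ as last (resp. second-to-last) player" if that player has a winning strategy when they are the last (resp. second-to-last) player. The outcome $o(H)$ is: $\mathcal{A}$ if Avoider wins on $H$ both as last player and as second-to-last player; $\mathcal{E}$ if Enforcer wins on $H$ both as last player and as second-to-last player; $\mathcal{SL}$ if whichever player is second-to-last wins (Avoider wins as second-to-last player and Enforcer wins as second-to-last player). These are the only three possibilities. The union $H_1\cup H_2$ has vertex set $V(H_1)\cup V(H_2)$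 and edge set $E(H_1)\cup E(H_2)$. *)

theory Defs
  imports Main
begin

record 'a hypergraph =
  verts :: "'a set"
  edges :: "'a set set"

definition is_hypergraph :: "'a hypergraph \<Rightarrow> bool" where
  "is_hypergraph H \<longleftrightarrow> finite (verts H) \<and> edges H \<subseteq> Pow (verts H)"

definition hunion :: "'a hypergraph \<Rightarrow> 'a hypergraph \<Rightarrow> 'a hypergraph" where
  "hunion H1 H2 = \<lparr>verts = verts H1 \<union> verts H2, edges = edges H1 \<union> edges H2\<rparr>"

datatype player = Avoider | Enforcer

fun opponent :: "player \<Rightarrow> player" where
  "opponent Avoider = Enforcer"
| "opponent Enforcer = Avoider"

text \<open>
  A position of the game is represented by its history, the list of the vertices picked so far in
  order. The parameter \<open>f\<close> is the player who makes the first move of the game;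
  moves are numbered from 0.
\<close>

definition turn :: "player \<Rightarrow> nat \<Rightarrow> player" where
  "turn f i = (if even i then f else opponent f)"

definition histories :: "'a hypergraph \<Rightarrow> 'a list set" where
  "histories H = {h. distinct h \<and> set h \<subseteq> verts H}"

definition plays :: "'a hypergraph \<Rightarrow> 'a list set" where
  "plays H = {p. distinct p \<and> set p = verts H}"

definition picked_by :: "player \<Rightarrow> player \<Rightarrow> 'a list \<Rightarrow> 'a set" where
  "picked_by f P p = {p ! i | i. i < length p \<and> turn f i = P}"

definition winner :: "'a hypergraph \<Rightarrow> player \<Rightarrow> 'a list \<Rightarrow> player" where
  "winner H f p = (if \<exists>e \<in> edges H. e \<subseteq> picked_by f Avoider p then Enforcer else Avoider)"

text \<open>
  A strategy maps histories to moves. It has to name an unpicked vertex at every unfinished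
  history in which it is the player's turn; without this requirement a strategy naming illegal
  moves would be followed by no play at all, and so would vacuously win.
\<close>

definition strategy :: "'a hypergraph \<Rightarrow> player \<Rightarrow> player \<Rightarrow> ('a list \<Rightarrow> 'a) \<Rightarrow> bool" where
  "strategy H f P \<sigma> \<longleftrightarrow>
     (\<forall>h \<in> histories H. set h \<noteq> verts H \<and> turn f (length h) = P \<longrightarrow> \<sigma> h \<in> verts H - set h)"

definition follows :: "player \<Rightarrow> player \<Rightarrow> ('a list \<Rightarrow> 'a) \<Rightarrow> 'a list \<Rightarrow> bool" where
  "follows f P \<sigma> p \<longleftrightarrow> (\<forall>i < length p. turn f i = P \<longrightarrow> p ! i = \<sigma> (take i p))"

definition has_winning_strategy :: "'a hypergraph \<Rightarrow> player \<Rightarrow> player \<Rightarrow> bool" where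
  "has_winning_strategy H f P \<longleftrightarrow>
     (\<exists>\<sigma>. strategy H f P \<sigma> \<and> (\<forall>p \<in> plays H. follows f P \<sigma> p \<longrightarrow> winner H f p = P))"

text \<open>
  If the vertex set is empty, no move is made, and the last player is by convention
  the second player (0 is even).
\<close>

definition last_player :: "'a hypergraph \<Rightarrow> player \<Rightarrow> player" where
  "last_player H f = (if odd (card (verts H)) then f else opponent f)"

text \<open>
  For each player \<open>P\<close> there is exactly one first player \<open>f\<close> making \<open>P\<close> the last player,
  and exactly one making \<open>P\<close> the second-to-last player.
\<close>

definition wins_as_last :: "'a hypergraph \<Rightarrow> player \<Rightarrow> bool" where
  "wins_as_last H P \<longleftrightarrow> (\<exists>f. last_player H f = P \<and> has_winning_strategy H f P)"

definition wins_as_second_to_last :: "'a hypergraph \<Rightarrow> player \<Rightarrow> bool" where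
  "wins_as_second_to_last H P \<longleftrightarrow>
     (\<exists>f. opponent (last_player H f) = P \<and> has_winning_strategy H f P)"

datatype outcome = Out_A | Out_E | Out_SL

fun has_outcome :: "'a hypergraph \<Rightarrow> outcome \<Rightarrow> bool" where
  "has_outcome H Out_A \<longleftrightarrow> wins_as_last H Avoider \<and> wins_as_second_to_last H Avoider"
| "has_outcome H Out_E \<longleftrightarrow> wins_as_last H Enforcer \<and> wins_as_second_to_last H Enforcer"
| "has_outcome H Out_SL \<longleftrightarrow>
     wins_as_second_to_last H Avoider \<and> wins_as_second_to_last H Enforcer"

text \<open>
  Exactly one of the three outcomes applies to every finite hypergraph: whoever wins as last
  player also wins as second-to-last player.
\<close>

definition outcome :: "'a hypergraph \<Rightarrow> outcome" where
  "outcome H = (THE X. has_outcome H X)"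

end

(* Everything follows from comparing positions by who picks the last vertex. For a fixed last
   player, an additional vertex on Avoider's side never hurts Enforcer and deleting a vertex
   never helps Enforcer, whatever the parity: if Enforcer wins after y is deleted, then he wins
   after Avoider picks x, for all x and y. Hence a move in one component never harms the
   opponent in that component. In a union, the player who has to win therefore always moves in
   a component where the parity says that it is his turn. *)

theory Submission
  imports Defs
begin

section \<open>The value of a position\<close>

text \<open>Indexing by the last player instead of the first lets the values on \<open>V\<close> and
  \<open>V - {x}\<close>, or on a component and the union, be compared for one fixed
  \<open>L\<close>.\<close>

definition mover :: "player \<Rightarrow> 'a set \<Rightarrow> player" where
  "mover L V = (if odd (card V) then L else opponent L)"

text \<open>In the position \<open>V\<close>, \<open>A\<close>, the vertices in \<open>V\<close> are unpicked and Avoider has picked those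
  in \<open>A\<close>; \<open>L\<close> is the player who makes the last move, so that the player to move is determined
  by the parity of \<open>V\<close>.\<close>

function enf_wins :: "'a set set \<Rightarrow> player \<Rightarrow> 'a set \<Rightarrow> 'a set \<Rightarrow> bool" where
  "enf_wins E L V A \<longleftrightarrow>
     (if infinite V \<or> V = {} then \<exists>e\<in>E. e \<subseteq> A
      else if mover L V = Avoider then \<forall>x\<in>V. enf_wins E L (V - {x}) (insert x A)
      else \<exists>x\<in>V. enf_wins E L (V - {x}) A)"
  by pat_completeness auto
text \<open>Infinite sets count as finished positions, so each recursive call removes a member of a
  finite set and \<open>card\<close> drops.\<close>

termination
  by (relation "measure (\<lambda>(E, L, V, A). card V)")
    (auto simp: card_gt_0_iff)

declare enf_wins.simps [simp del]

lemma opponent_opponent [simp]: "opponent (opponent P) = P"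
  by (cases P) auto

lemma opponent_eq_iff: "opponent P = Q \<longleftrightarrow> P \<noteq> Q"
  by (cases P; cases Q) auto

lemma mover_remove:
  assumes "finite V" "x \<in> V"
  shows "mover L (V - {x}) = opponent (mover L V)"
proof -
  have "card V = Suc (card (V - {x}))"
    using assms by (metis card.remove)
  then show ?thesis by (auto simp: mover_def)
qed

lemma enf_wins_empty [simp]: "enf_wins E L {} A \<longleftrightarrow> (\<exists>e\<in>E. e \<subseteq> A)"
  by (simp add: enf_wins.simps)

lemma enf_wins_Avoider:
  assumes "finite V" "mover L V = Avoider" "V \<noteq> {}"
  shows "enf_wins E L V A \<longleftrightarrow> (\<forall>x\<in>V. enf_wins E L (V - {x}) (insert x A))"
  using assms by (subst enf_wins.simps) simp

lemma enf_wins_Enforcer: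
  assumes "finite V" "mover L V = Enforcer" "V \<noteq> {}"
  shows "enf_wins E L V A \<longleftrightarrow> (\<exists>x\<in>V. enf_wins E L (V - {x}) A)"
  using assms by (subst enf_wins.simps) simp

lemma enf_wins_mono:
  assumes "finite V" "enf_wins E L V A" "E \<subseteq> E'" "A \<subseteq> A'"
  shows "enf_wins E' L V A'"
  using assms
proof (induction V arbitrary: A A' rule: finite_psubset_induct)
  case (psubset V)
  have IH: "enf_wins E' L (V - {x}) B'"
    if "x \<in> V" "enf_wins E L (V - {x}) B" "B \<subseteq> B'" for x B B'
    using psubset.IH[of "V - {x}" B B'] that psubset.prems by blast
  consider "V = {}" | "V \<noteq> {}" "mover L V = Avoider" | "V \<noteq> {}" "mover L V = Enforcer"
    by (metis player.exhaust)
  then show ?case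
  proof cases
    case 1
    then obtain e where "e \<in> E" "e \<subseteq> A" using psubset.prems(1) by auto
    then have "e \<in> E'" "e \<subseteq> A'"
      using subsetD[OF psubset.prems(2)] order_trans[OF _ psubset.prems(3)] by simp_all
    then show ?thesis using 1 by auto
  next
    case 2
    then have "enf_wins E' L (V - {x}) (insert x A')" if "x \<in> V" for x
      using that psubset.prems psubset.hyps
      by (intro IH[of x "insert x A"]) (auto simp: enf_wins_Avoider)
    then show ?thesis using 2 psubset.hyps by (simp add: enf_wins_Avoider)
  next
    case 3
    then obtain x where "x \<in> V" "enf_wins E L (V - {x}) A"
      using psubset.prems psubset.hyps by (auto simp: enf_wins_Enforcer)
    then show ?thesis using 3 psubset.hyps IH[of x A A'] psubset.prems
      by (auto simp: enf_wins_Enforcer)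
  qed
qed

lemma enf_wins_insert:
  assumes "finite V" "enf_wins E L V A"
  shows "enf_wins E L V (insert x A)"
  using enf_wins_mono[OF assms order_refl subset_insertI] .

text \<open>In a union both components are evaluated with one common \<open>A\<close>; this makes
  the value of a component blind to Avoider's picks in the other.\<close>

lemma enf_wins_insert_irrelevant:
  assumes "finite V" "y \<notin> \<Union>E"
  shows "enf_wins E L V (insert y A) \<longleftrightarrow> enf_wins E L V A"
  using assms(1)
proof (induction V arbitrary: A rule: finite_psubset_induct)
  case (psubset V)
  have IH: "enf_wins E L (V - {x}) (insert y B) = enf_wins E L (V - {x}) B" if "x \<in> V" for x B
    using that by (intro psubset.IH) auto
  consider "V = {}" | "V \<noteq> {}" "mover L V = Avoider" | "V \<noteq> {}" "mover L V = Enforcer"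
    by (metis player.exhaust)
  then show ?case
  proof cases
    case 1
    then show ?thesis using assms(2) by (auto simp: subset_insert)
  next
    case 2
    then show ?thesis using psubset.hyps IH
      by (simp add: enf_wins_Avoider insert_commute[of _ y])
  next
    case 3
    then show ?thesis using psubset.hyps IH by (simp add: enf_wins_Enforcer)
  qed
qed

section \<open>Free moves and exchange of the last player\<close>

text \<open>Both positions have equally many unpicked vertices, hence the same mover. Enforcer
  copies an imagined game on \<open>V - {y}\<close>, with the free \<open>y\<close> of the real game
  in the role of the imagined \<open>x\<close>; that Avoider already owns \<open>x\<close> in the
  real game can only help Enforcer.\<close>

lemma enf_wins_swap:
  assumes "finite V" "x \<in> V" "y \<in> V" "enf_wins E L (V - {y}) A"
  shows "enf_wins E L (V - {x}) (insert x A)"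
  using assms
proof (induction V arbitrary: A rule: finite_psubset_induct)
  case (psubset V)
  show ?case
  proof (cases "x = y")
    case True
    then show ?thesis using psubset.prems psubset.hyps by (simp add: enf_wins_insert)
  next
    case False
    have comm: "V - {a} - {b} = V - {b} - {a}" for a b by blast
    have fin: "finite (V - {a})" for a using psubset.hyps by simp
    have ne: "V - {x} \<noteq> {}" "V - {y} \<noteq> {}" using False psubset.prems by auto
    have movers: "mover L (V - {y}) = mover L (V - {x})"
      using psubset.prems psubset.hyps by (simp add: mover_remove)
    have IH: "enf_wins E L (V - {w} - {x}) (insert x B)"
      if "w \<in> V" "w \<noteq> x" "w \<noteq> y" "enf_wins E L (V - {y} - {w}) B" for w B
      using psubset.IH[of "V - {w}" B] that psubset.prems comm[of y w] by auto
    show ?thesis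
    proof (cases "mover L (V - {x})")
      case Avoider
      have all: "enf_wins E L (V - {y} - {w}) (insert w A)" if "w \<in> V - {y}" for w
        using psubset.prems Avoider movers ne fin that by (auto simp: enf_wins_Avoider)
      have "enf_wins E L (V - {x} - {w}) (insert w (insert x A))" if w: "w \<in> V - {x}" for w
      proof (cases "w = y")
        case True
        \<comment> \<open>Avoider's pick of \<open>y\<close> is read as a pick of \<open>x\<close>
          in the imagined game; afterwards \<open>y\<close> is just one more vertex owned by
          Avoider.\<close>
        have "enf_wins E L (V - {x} - {w}) (insert x A)"
          using all[of x] False psubset.prems True comm[of x y] by simp
        then show ?thesis using fin by (simp add: enf_wins_insert)
      next
        case False
        then show ?thesis
          using IH[of w "insert w A"] all[of w] w comm[of x w] by (simp add: insert_commute)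
      qed
      then show ?thesis using Avoider ne fin by (simp add: enf_wins_Avoider)
    next
      case Enforcer
      then obtain v where v: "v \<in> V - {y}" "enf_wins E L (V - {y} - {v}) A"
        using psubset.prems movers ne fin by (auto simp: enf_wins_Enforcer)
      have "\<exists>u\<in>V - {x}. enf_wins E L (V - {x} - {u}) (insert x A)"
      proof (cases "v = x")
        case True
        \<comment> \<open>The imagined winning move \<open>x\<close> is already taken, so Enforcer
          picks \<open>y\<close> in its place.\<close>
        then have "enf_wins E L (V - {x} - {y}) A" using v comm[of x y] by simp
        then have "enf_wins E L (V - {x} - {y}) (insert x A)"
          using fin by (simp add: enf_wins_insert)
        then show ?thesis using psubset.prems False by blast
      next
        case False
        then have "enf_wins E L (V - {x} - {v}) (insert x A)"
          using IH[of v A] v comm[of x v] by simp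
        then show ?thesis using v False by blast
      qed
      then show ?thesis using Enforcer ne fin by (simp add: enf_wins_Enforcer)
    qed
  qed
qed

text \<open>Covers Avoider entering a component where it is Enforcer's turn:
  \<open>enf_wins_swap\<close> then applies to Enforcer's winning move \<open>y\<close>.\<close>

lemma enf_wins_pick:
  assumes "finite V" "x \<in> V" "enf_wins E L V A"
  shows "enf_wins E L (V - {x}) (insert x A)"
proof -
  have ne: "V \<noteq> {}" using assms by blast
  show ?thesis
  proof (cases "mover L V")
    case Avoider
    then show ?thesis using assms by (auto simp: ne enf_wins_Avoider)
  next
    case Enforcer
    then obtain y where "y \<in> V" "enf_wins E L (V - {y}) A"
      using assms by (auto simp: ne enf_wins_Enforcer)
    then show ?thesis using assms(2) enf_wins_swap[OF assms(1)] by blast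
  qed
qed

text \<open>If Avoider is to move, \<open>enf_wins_swap\<close> handles each pick \<open>w\<close>;
  otherwise Enforcer may delete \<open>x\<close> by moving there. Read contrapositively, a move of
  Enforcer in a component never harms Avoider there, in turn or not.\<close>

lemma enf_wins_delete:
  assumes "finite V" "x \<in> V" "enf_wins E L (V - {x}) A"
  shows "enf_wins E L V A"
proof -
  have ne: "V \<noteq> {}" using assms by blast
  show ?thesis
  proof (cases "mover L V")
    case Avoider
    have "enf_wins E L (V - {w}) (insert w A)" if "w \<in> V" for w
      using enf_wins_swap[OF assms(1) that assms(2,3)] .
    then show ?thesis using assms Avoider by (auto simp: ne enf_wins_Avoider)
  next
    case Enforcer
    then show ?thesis using assms by (auto simp: ne enf_wins_Enforcer)
  qed
qed

lemma enf_wins_delete_set: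
  assumes "finite V" "finite W" "enf_wins E L V A"
  shows "enf_wins E L (V \<union> W) A"
  using assms(2)
proof induction
  case empty
  then show ?case using assms by simp
next
  case (insert x W)
  then show ?case
    using assms enf_wins_delete[of "V \<union> insert x W" x E L A]
    by (cases "x \<in> V") (auto simp: insert_absorb)
qed

text \<open>The finished position on \<open>{}\<close> is won, and all of \<open>V\<close> can be
  put back.\<close>

lemma enf_wins_if_edge:
  assumes "finite V" "\<exists>e\<in>E. e \<subseteq> A"
  shows "enf_wins E L V A"
  using enf_wins_delete_set[of "{}" V E L A] assms by simp

section \<open>Comparison of the two choices of last player\<close>

lemma enf_wins_second_to_last:
  assumes "finite V" "enf_wins E Enforcer V A"
  shows "enf_wins E Avoider V A"
proof -
  text \<open>Enforcer, who is not last, pretends that Avoider has already picked some \<open>x\<close>; in the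
    imagined game he is last. If Avoider later picks \<open>x\<close>, both games coincide.\<close>
  have pretend: "(enf_wins E Enforcer V A \<longrightarrow> enf_wins E Avoider V A) \<and>
      (\<forall>x\<in>V. enf_wins E Enforcer (V - {x}) (insert x A) \<longrightarrow> enf_wins E Avoider V A)"
    using assms(1)
  proof (induction V arbitrary: A rule: finite_psubset_induct)
    case (psubset V)
    have fin: "finite (V - {a})" for a using psubset.hyps by simp
    have one: "enf_wins E Avoider V A"
      if x: "x \<in> V" and win: "enf_wins E Enforcer (V - {x}) (insert x A)" for x
    proof (cases "mover Avoider V")
      case Avoider
      have "V \<noteq> {}" using x by blast
      \<comment> \<open>Changing the last player and removing one vertex each flip the mover, so the
        same player moves in the real and the imagined game.\<close>
      have mv: "V - {x} \<noteq> {} \<Longrightarrow> mover Enforcer (V - {x}) = Avoider"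
        using Avoider x psubset.hyps by (auto simp: mover_remove mover_def split: if_splits)
      have "enf_wins E Avoider (V - {w}) (insert w A)" if w: "w \<in> V" for w
      proof (cases "w = x")
        case True
        \<comment> \<open>The positions now agree, but the last players still differ; the first
          conjunct of the induction hypothesis bridges this.\<close>
        then show ?thesis using psubset.IH[of "V - {x}"] x win by blast
      next
        case False
        then have ne: "V - {x} \<noteq> {}" using w by blast
        have "enf_wins E Enforcer (V - {x} - {w}) (insert w (insert x A))"
          using win mv ne fin w False by (auto simp: enf_wins_Avoider)
        moreover have "V - {x} - {w} = V - {w} - {x}" by blast
        ultimately have "enf_wins E Enforcer (V - {w} - {x}) (insert x (insert w A))"
          by (simp add: insert_commute)
        then show ?thesis using psubset.IH[of "V - {w}" "insert w A"] x w False by blast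
      qed
      then show ?thesis using Avoider \<open>V \<noteq> {}\<close> psubset.hyps by (simp add: enf_wins_Avoider)
    next
      case Enforcer
      \<comment> \<open>Here \<open>card V\<close> is even and positive, so a vertex other than
        \<open>x\<close> remains for Enforcer's imagined move.\<close>
      then have "odd (card (V - {x}))"
        using x psubset.hyps by (cases "card V") (auto simp: mover_def card_gt_0_iff)
      then have mv: "mover Enforcer (V - {x}) = Enforcer" and ne: "V - {x} \<noteq> {}"
        by (simp_all only: mover_def if_True not_False_eq_True) (metis card.empty even_zero)
      then obtain y where y: "y \<in> V" "y \<noteq> x"
        "enf_wins E Enforcer (V - {x} - {y}) (insert x A)"
        using win fin by (auto simp: enf_wins_Enforcer)
      moreover have "V - {x} - {y} = V - {y} - {x}" by blast
      ultimately have "enf_wins E Avoider (V - {y}) A"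
        using psubset.IH[of "V - {y}" A] x by auto
      moreover have "V \<noteq> {}" using x by blast
      ultimately show ?thesis using Enforcer y psubset.hyps by (auto simp: enf_wins_Enforcer)
    qed
    moreover have "enf_wins E Avoider V A" if "enf_wins E Enforcer V A"
    proof (cases "V = {}")
      case True
      then show ?thesis using that by simp
    next
      case False
      \<comment> \<open>The pretence starts here: by \<open>enf_wins_pick\<close>, any
        \<open>x\<close> can be handed to Avoider.\<close>
      then show ?thesis using one enf_wins_pick[OF psubset.hyps _ that] by blast
    qed
    ultimately show ?case by blast
  qed
  then show ?thesis using assms by blast
qed

section \<open>Disjoint unions\<close>

text \<open>Further edges help by monotonicity, and the vertices of \<open>V2\<close> can be put
  back without harm.\<close>

lemma enf_wins_union_left:
  assumes "finite V1" "finite V2" "enf_wins E1 L V1 A"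
  shows "enf_wins (E1 \<union> E2) L (V1 \<union> V2) A"
  using enf_wins_delete_set[OF assms(1,2)] enf_wins_mono[OF assms(1,3) Un_upper1 order_refl] .

text \<open>Edges need only miss the unpicked vertices of the other component: they may contain
  vertices already picked, so the condition persists as play shrinks \<open>V1\<close> and
  \<open>V2\<close>.\<close>

locale split_position =
  fixes V1 V2 :: "'a set" and E1 E2 :: "'a set set"
  assumes fin: "finite V1" "finite V2"
    and disj: "V1 \<inter> V2 = {}"
    and irrelevant: "\<Union>E1 \<inter> V2 = {}" "\<Union>E2 \<inter> V1 = {}"
begin

lemma remove1: "split_position (V1 - {x}) V2 E1 E2"
  using fin disj irrelevant by unfold_locales auto

lemma remove2: "split_position V1 (V2 - {x}) E1 E2"
  using fin disj irrelevant by unfold_locales auto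

lemma union_minus1: "x \<in> V1 \<Longrightarrow> V1 \<union> V2 - {x} = (V1 - {x}) \<union> V2"
  using disj by blast

lemma union_minus2: "x \<in> V2 \<Longrightarrow> V1 \<union> V2 - {x} = V1 \<union> (V2 - {x})"
  using disj by blast

lemma insert1: "x \<in> V1 \<Longrightarrow> enf_wins E2 L V2 (insert x A) \<longleftrightarrow> enf_wins E2 L V2 A"
  using irrelevant(2) by (intro enf_wins_insert_irrelevant[OF fin(2)]) blast

lemma insert2: "x \<in> V2 \<Longrightarrow> enf_wins E1 L V1 (insert x A) \<longleftrightarrow> enf_wins E1 L V1 A"
  using irrelevant(1) by (intro enf_wins_insert_irrelevant[OF fin(1)]) blast

lemma card_union: "card (V1 \<union> V2) = card V1 + card V2"
  using fin disj by (simp add: card_Un_disjoint)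

end

text \<open>Enforcer keeps both components won. Avoider's moves are absorbed by
  \<open>enf_wins_pick\<close>; Enforcer replies in a component where parity gives Enforcer the
  turn.\<close>

lemma enf_wins_union_SL:
  assumes "split_position V1 V2 E1 E2"
    and "enf_wins E1 Avoider V1 A" "enf_wins E2 Avoider V2 A"
  shows "enf_wins (E1 \<union> E2) Enforcer (V1 \<union> V2) A"
  using assms
proof (induction "card V1 + card V2" arbitrary: V1 V2 A rule: less_induct)
  case less
  interpret split_position V1 V2 E1 E2 by fact
  have IH1: "enf_wins (E1 \<union> E2) Enforcer (V1 \<union> V2 - {x}) B"
    if "x \<in> V1" "enf_wins E1 Avoider (V1 - {x}) B" "enf_wins E2 Avoider V2 B" for x B
    using less.hyps[of "V1 - {x}" V2 B] remove1 union_minus1 that card_Diff1_less[OF fin(1)]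
    by simp
  have IH2: "enf_wins (E1 \<union> E2) Enforcer (V1 \<union> V2 - {x}) B"
    if "x \<in> V2" "enf_wins E1 Avoider V1 B" "enf_wins E2 Avoider (V2 - {x}) B" for x B
    using less.hyps[of V1 "V2 - {x}" B] remove2 union_minus2 that card_Diff1_less[OF fin(2)]
    by simp
  have finU: "finite (V1 \<union> V2)" using fin by simp
  show ?case
  proof (cases "V1 = {} \<or> V2 = {}")
    case True
    \<comment> \<open>A won component that is exhausted already holds a completed edge.\<close>
    then have "\<exists>e\<in>E1 \<union> E2. e \<subseteq> A" using less.prems(2,3) by (metis UnI1 UnI2 enf_wins_empty)
    then show ?thesis using finU by (rule enf_wins_if_edge[rotated])
  next
    case False
    then have ne: "V1 \<noteq> {}" "V2 \<noteq> {}" by auto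
    show ?thesis
    proof (cases "mover Enforcer (V1 \<union> V2)")
      case Avoider
      have "enf_wins (E1 \<union> E2) Enforcer (V1 \<union> V2 - {x}) (insert x A)" if "x \<in> V1 \<union> V2" for x
      proof (cases "x \<in> V1")
        case True
        then show ?thesis
          using IH1 insert1 enf_wins_pick[OF fin(1)] less.prems by blast
      next
        case False
        then show ?thesis
          using that IH2 insert2 enf_wins_pick[OF fin(2)] less.prems by blast
      qed
      then show ?thesis using Avoider finU ne by (simp add: enf_wins_Avoider)
    next
      case Enforcer
      \<comment> \<open>The total is odd, so one component is even, and with Avoider last there it
        is Enforcer's turn in it.\<close>
      then consider "mover Avoider V1 = Enforcer" | "mover Avoider V2 = Enforcer"
        using card_union by (auto simp: mover_def split: if_splits)
      then have "\<exists>x\<in>V1 \<union> V2. enf_wins (E1 \<union> E2) Enforcer (V1 \<union> V2 - {x}) A"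
      proof cases
        case 1
        then obtain x where "x \<in> V1" "enf_wins E1 Avoider (V1 - {x}) A"
          using less.prems ne fin by (auto simp: enf_wins_Enforcer)
        then show ?thesis using IH1 less.prems by blast
      next
        case 2
        then obtain x where "x \<in> V2" "enf_wins E2 Avoider (V2 - {x}) A"
          using less.prems ne fin by (auto simp: enf_wins_Enforcer)
        then show ?thesis using IH2 less.prems by blast
      qed
      then show ?thesis using Enforcer finU ne by (simp add: enf_wins_Enforcer)
    qed
  qed
qed

text \<open>Later picks come from \<open>V\<close>, which the edges in \<open>E'\<close> avoid, so
  an edge of \<open>E'\<close> incomplete now stays incomplete. This discards an exhausted
  component.\<close>

lemma enf_wins_dead_edges:
  assumes "finite V" "\<Union>E' \<inter> V = {}" "\<not> (\<exists>e\<in>E'. e \<subseteq> A)"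
  shows "enf_wins (E \<union> E') L V A \<longleftrightarrow> enf_wins E L V A"
  using assms
proof (induction V arbitrary: A rule: finite_psubset_induct)
  case (psubset V)
  have IH: "enf_wins (E \<union> E') L (V - {x}) B = enf_wins E L (V - {x}) B"
    if "x \<in> V" "\<not> (\<exists>e\<in>E'. e \<subseteq> B)" for x B
    using that psubset.prems by (intro psubset.IH) auto
  have "\<not> (\<exists>e\<in>E'. e \<subseteq> insert x A)" if "x \<in> V" for x
    using that psubset.prems by (auto simp: subset_insert disjoint_iff)
  note IH' = IH[OF _ this] IH[OF _ psubset.prems(2)]
  consider "V = {}" | "V \<noteq> {}" "mover L V = Avoider" | "V \<noteq> {}" "mover L V = Enforcer"
    by (metis player.exhaust)
  then show ?case
  proof cases
    case 1
    then show ?thesis using psubset.prems by auto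
  next
    case 2
    then show ?thesis using psubset.hyps IH' by (simp add: enf_wins_Avoider)
  next
    case 3
    then show ?thesis using psubset.hyps IH' by (simp add: enf_wins_Enforcer)
  qed
qed

text \<open>Avoider keeps both components won: Enforcer's moves are absorbed by
  \<open>enf_wins_delete\<close>, and some component always offers Avoider a move in turn.\<close>

lemma Avoider_wins_union:
  assumes "split_position V1 V2 E1 E2"
    and "\<not> enf_wins E1 Avoider V1 A" "\<not> enf_wins E2 L V2 A"
  shows "\<not> enf_wins (E1 \<union> E2) L (V1 \<union> V2) A"
  using assms
proof (induction "card V1 + card V2" arbitrary: V1 V2 A rule: less_induct)
  case less
  interpret split_position V1 V2 E1 E2 by fact
  have IH1: "\<not> enf_wins (E1 \<union> E2) L (V1 \<union> V2 - {x}) B"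
    if "x \<in> V1" "\<not> enf_wins E1 Avoider (V1 - {x}) B" "\<not> enf_wins E2 L V2 B" for x B
    using less.hyps[of "V1 - {x}" V2 B] remove1 union_minus1 that card_Diff1_less[OF fin(1)]
    by simp
  have IH2: "\<not> enf_wins (E1 \<union> E2) L (V1 \<union> V2 - {x}) B"
    if "x \<in> V2" "\<not> enf_wins E1 Avoider V1 B" "\<not> enf_wins E2 L (V2 - {x}) B" for x B
    using less.hyps[of V1 "V2 - {x}" B] remove2 union_minus2 that card_Diff1_less[OF fin(2)]
    by simp
  have finU: "finite (V1 \<union> V2)" using fin by simp
  show ?case
  proof (cases "V2 = {}")
    case True
    \<comment> \<open>Winning as last player is the harder task for Avoider, so the first component
      is won for either \<open>L\<close>.\<close>
    have "\<not> enf_wins E1 L V1 A"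
      using less.prems(2) enf_wins_second_to_last[OF fin(1)] by (cases L) auto
    then show ?thesis
      using enf_wins_dead_edges[OF fin(1) irrelevant(2)] less.prems True by simp
  next
    case False
    show ?thesis
    proof (cases "mover L (V1 \<union> V2)")
      case Avoider
      \<comment> \<open>If \<open>card V1\<close> is even, \<open>V2\<close> has the parity of the
        union and hence the same mover.\<close>
      then have "odd (card V1) \<or> mover L V2 = Avoider"
        using card_union by (cases L) (auto simp: mover_def split: if_splits)
      then consider "mover Avoider V1 = Avoider" "V1 \<noteq> {}" | "mover L V2 = Avoider"
        by (metis card.empty even_zero mover_def)
      then have "\<exists>x\<in>V1 \<union> V2. \<not> enf_wins (E1 \<union> E2) L (V1 \<union> V2 - {x}) (insert x A)"
      proof cases
        case 1
        then obtain x where "x \<in> V1" "\<not> enf_wins E1 Avoider (V1 - {x}) (insert x A)"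
          using less.prems fin by (auto simp: enf_wins_Avoider)
        then show ?thesis using IH1 insert1 less.prems by blast
      next
        case 2
        then obtain x where "x \<in> V2" "\<not> enf_wins E2 L (V2 - {x}) (insert x A)"
          using less.prems False fin by (auto simp: enf_wins_Avoider)
        then show ?thesis using IH2 insert2 less.prems by blast
      qed
      then show ?thesis using Avoider finU False by (simp add: enf_wins_Avoider)
    next
      case Enforcer
      have "\<not> enf_wins (E1 \<union> E2) L (V1 \<union> V2 - {x}) A" if "x \<in> V1 \<union> V2" for x
      proof (cases "x \<in> V1")
        case True
        then show ?thesis using IH1 enf_wins_delete[OF fin(1)] less.prems by blast
      next
        case False
        then show ?thesis using that IH2 enf_wins_delete[OF fin(2)] less.prems by blast
      qed
      then show ?thesis using Enforcer finU False by (simp add: enf_wins_Enforcer)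
    qed
  qed
qed

section \<open>Strategies\<close>

lemma mem_histories_snoc:
  "h @ [x] \<in> histories H \<longleftrightarrow> h \<in> histories H \<and> x \<in> verts H - set h"
  by (auto simp: histories_def)

lemma picked_by_Nil [simp]: "picked_by f P [] = {}"
  by (simp add: picked_by_def)

lemma picked_by_snoc:
  "picked_by f P (h @ [x]) =
    (if turn f (length h) = P then insert x (picked_by f P h) else picked_by f P h)"
proof -
  have "picked_by f P q = (!) q ` {i. i < length q \<and> turn f i = P}" for q :: "'a list"
    by (auto simp: picked_by_def)
  moreover have "{i. i < length (h @ [x]) \<and> turn f i = P} =
      (if turn f (length h) = P then insert (length h) {i. i < length h \<and> turn f i = P}
       else {i. i < length h \<and> turn f i = P})"
    by (auto simp: less_Suc_eq)
  moreover have "(!) (h @ [x]) ` {i. i < length h \<and> turn f i = P} =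
      (!) h ` {i. i < length h \<and> turn f i = P}"
    by (rule image_cong) (auto simp: nth_append)
  ultimately show ?thesis by simp
qed

lemma follows_snoc:
  "follows f P \<sigma> (h @ [x]) \<longleftrightarrow> follows f P \<sigma> h \<and> (turn f (length h) = P \<longrightarrow> x = \<sigma> h)"
  by (auto simp: follows_def nth_append less_Suc_eq)

text \<open>Replaces an explicit strategy by an invariant that \<open>P\<close> can always preserve
  and the opponent cannot break.\<close>

lemma has_winning_strategyI:
  assumes "I []"
    and own: "\<And>h. h \<in> histories H \<Longrightarrow> I h \<Longrightarrow> set h \<noteq> verts H \<Longrightarrow> turn f (length h) = P \<Longrightarrow>
      \<exists>x\<in>verts H - set h. I (h @ [x])"
    and other: "\<And>h x. h \<in> histories H \<Longrightarrow> I h \<Longrightarrow> turn f (length h) \<noteq> P \<Longrightarrow>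
      x \<in> verts H - set h \<Longrightarrow> I (h @ [x])"
    and final: "\<And>p. p \<in> plays H \<Longrightarrow> I p \<Longrightarrow> winner H f p = P"
  shows "has_winning_strategy H f P"
proof -
  \<comment> \<open>The implication keeps the choice legal even where \<open>I\<close> fails, as
    \<open>strategy\<close> demands a legal move at every history where \<open>P\<close> is to
    move.\<close>
  define \<sigma> where "\<sigma> h = (SOME x. x \<in> verts H - set h \<and> (I h \<longrightarrow> I (h @ [x])))" for h
  have \<sigma>: "\<sigma> h \<in> verts H - set h \<and> (I h \<longrightarrow> I (h @ [\<sigma> h]))"
    if "h \<in> histories H" "set h \<noteq> verts H" "turn f (length h) = P" for h
    unfolding \<sigma>_def
  proof (rule someI_ex)
    show "\<exists>x. x \<in> verts H - set h \<and> (I h \<longrightarrow> I (h @ [x]))"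
      using own[OF that(1) _ that(2,3)] that by (cases "I h") (auto simp: histories_def)
  qed
  have "I h" if "h \<in> histories H" "follows f P \<sigma> h" for h
    using that
  proof (induction h rule: rev_induct)
    case Nil
    then show ?case using assms(1) by simp
  next
    case (snoc x h)
    then have h: "h \<in> histories H" "x \<in> verts H - set h" "I h" "turn f (length h) = P \<longrightarrow> x = \<sigma> h"
      by (auto simp: mem_histories_snoc follows_snoc)
    then show ?case using \<sigma>[OF h(1)] other[OF h(1,3) _ h(2)] by blast
  qed
  then have "\<forall>p\<in>plays H. follows f P \<sigma> p \<longrightarrow> winner H f p = P"
    using final by (simp add: plays_def histories_def)
  then show ?thesis
    using \<sigma> by (auto simp: has_winning_strategy_def strategy_def)
qed

text \<open>Playing the two strategies against each other yields one complete play that both players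
  would win.\<close>

lemma not_both_winning_strategies:
  assumes "finite (verts H)"
  shows "\<not> (has_winning_strategy H f Avoider \<and> has_winning_strategy H f Enforcer)"
proof
  assume "has_winning_strategy H f Avoider \<and> has_winning_strategy H f Enforcer"
  then obtain \<sigma> \<tau> where
    \<sigma>: "strategy H f Avoider \<sigma>" "\<forall>p\<in>plays H. follows f Avoider \<sigma> p \<longrightarrow> winner H f p = Avoider" and
    \<tau>: "strategy H f Enforcer \<tau>" "\<forall>p\<in>plays H. follows f Enforcer \<tau> p \<longrightarrow> winner H f p = Enforcer"
    unfolding has_winning_strategy_def by blast
  have "\<exists>h\<in>histories H. length h = n \<and> follows f Avoider \<sigma> h \<and> follows f Enforcer \<tau> h"
    if "n \<le> card (verts H)" for n
    using that
  proof (induction n)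
    case 0
    then show ?case by (auto simp: histories_def follows_def)
  next
    case (Suc n)
    then obtain h where h: "h \<in> histories H" "length h = n" "follows f Avoider \<sigma> h"
      "follows f Enforcer \<tau> h"
      by auto
    have "set h \<noteq> verts H" using h Suc.prems by (auto simp: histories_def dest: distinct_card)
    then have "\<exists>x\<in>verts H - set h. (turn f n = Avoider \<longrightarrow> x = \<sigma> h) \<and> (turn f n = Enforcer \<longrightarrow> x = \<tau> h)"
      using \<sigma>(1) \<tau>(1) h by (cases "turn f n") (auto simp: strategy_def)
    then obtain x where "x \<in> verts H - set h" "turn f n = Avoider \<longrightarrow> x = \<sigma> h"
      "turn f n = Enforcer \<longrightarrow> x = \<tau> h"
      by blast
    then show ?case using h
      by (intro bexI[of _ "h @ [x]"]) (simp_all add: mem_histories_snoc follows_snoc)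
  qed
  then obtain p where p: "p \<in> histories H" "length p = card (verts H)"
    "follows f Avoider \<sigma> p" "follows f Enforcer \<tau> p"
    by blast
  then have "p \<in> plays H"
    using assms by (simp add: histories_def plays_def card_subset_eq distinct_card)
  then show False using \<sigma>(2) \<tau>(2) p by auto
qed

text \<open>The equation says that the value favours \<open>P\<close>, which treats both players at
  once. The invariant is that the current position still favours \<open>P\<close>.\<close>

lemma has_winning_strategy_value:
  assumes "finite (verts H)"
    and "(P = Enforcer) = enf_wins (edges H) (last_player H f) (verts H) {}"
  shows "has_winning_strategy H f P"
proof -
  let ?L = "last_player H f"
  let ?val = "\<lambda>h. enf_wins (edges H) ?L (verts H - set h) (picked_by f Avoider h)"
  have mover: "turn f (length h) = mover ?L (verts H - set h)" if "h \<in> histories H" for h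
  proof -
    have "card (verts H) = card (verts H - set h) + length h"
      using that assms(1)
      by (metis (mono_tags, lifting) List.finite_set card_Diff_subset card_mono distinct_card
          histories_def le_add_diff_inverse2 mem_Collect_eq)
    then show ?thesis by (auto simp: mover_def turn_def last_player_def)
  qed
  have rest: "verts H - set (h @ [x]) = verts H - set h - {x}" for h x by auto
  have fin: "finite (verts H - set h)" for h using assms(1) by simp
  have step: "?val (h @ [x]) = enf_wins (edges H) ?L (verts H - set h - {x})
      (if turn f (length h) = Avoider then insert x (picked_by f Avoider h)
       else picked_by f Avoider h)" for h x
    unfolding rest picked_by_snoc ..
  show ?thesis
  proof (rule has_winning_strategyI[where I = "\<lambda>h. (P = Enforcer) = ?val h"])
    show "(P = Enforcer) = ?val []" using assms(2) by simp
  next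
    fix h assume h: "h \<in> histories H" "(P = Enforcer) = ?val h" "set h \<noteq> verts H"
      "turn f (length h) = P"
    then have "verts H - set h \<noteq> {}" by (auto simp: histories_def)
    then show "\<exists>x\<in>verts H - set h. (P = Enforcer) = ?val (h @ [x])"
      using h mover[OF h(1)] fin unfolding step
      by (cases P) (auto simp: enf_wins_Avoider enf_wins_Enforcer)
  next
    fix h x assume h: "h \<in> histories H" "(P = Enforcer) = ?val h" "turn f (length h) \<noteq> P"
      "x \<in> verts H - set h"
    then have "verts H - set h \<noteq> {}" by auto
    moreover have "turn f (length h) = opponent P" using h(3) by (metis opponent_eq_iff)
    ultimately show "(P = Enforcer) = ?val (h @ [x])"
      using h mover[OF h(1)] fin unfolding step
      by (cases P) (auto simp: enf_wins_Avoider enf_wins_Enforcer)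
  next
    fix p assume "p \<in> plays H" "(P = Enforcer) = ?val p"
    then show "winner H f p = P"
      by (cases P) (auto simp: plays_def winner_def)
  qed
qed

text \<open>The player favoured by the value has a winning strategy, so the other player cannot have
  one.\<close>

lemma has_winning_strategy_iff:
  assumes "finite (verts H)"
  shows "has_winning_strategy H f P \<longleftrightarrow>
    (P = Enforcer) = enf_wins (edges H) (last_player H f) (verts H) {}"
  using has_winning_strategy_value[OF assms, of Avoider f]
    has_winning_strategy_value[OF assms, of Enforcer f] not_both_winning_strategies[OF assms, of f]
  by (cases P) auto

lemma ex_last_player: "\<exists>f. last_player H f = P"
  by (cases "odd (card (verts H))") (auto simp: last_player_def intro: exI[of _ "opponent P"])

section \<open>Outcomes read off from values\<close>

lemma wins_as_last_iff:
  assumes "finite (verts H)"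
  shows "wins_as_last H P \<longleftrightarrow> (P = Enforcer) = enf_wins (edges H) P (verts H) {}"
  using ex_last_player[of H P] has_winning_strategy_iff[OF assms] by (auto simp: wins_as_last_def)

lemma wins_as_second_to_last_iff:
  assumes "finite (verts H)"
  shows "wins_as_second_to_last H P \<longleftrightarrow>
    (P = Enforcer) = enf_wins (edges H) (opponent P) (verts H) {}"
  using ex_last_player[of H "opponent P"] has_winning_strategy_iff[OF assms]
  unfolding wins_as_second_to_last_def by (metis opponent_opponent)

lemma outcome_eq:
  assumes "finite (verts H)"
  shows "outcome H =
    (if enf_wins (edges H) Enforcer (verts H) {} then Out_E
     else if enf_wins (edges H) Avoider (verts H) {} then Out_SL else Out_A)"
proof -
  \<comment> \<open>\<open>enf_wins_second_to_last\<close> rules out the fourth combination of the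
    two values, so exactly one outcome fits and \<open>THE\<close> is well defined.\<close>
  have "has_outcome H X \<longleftrightarrow> X =
    (if enf_wins (edges H) Enforcer (verts H) {} then Out_E
     else if enf_wins (edges H) Avoider (verts H) {} then Out_SL else Out_A)" for X
    using enf_wins_second_to_last[OF assms, of "edges H" "{}"]
    by (cases X) (auto simp: wins_as_last_iff[OF assms] wins_as_second_to_last_iff[OF assms])
  then show ?thesis unfolding outcome_def by (intro the_equality) blast+
qed

theorem theorem2p6:
  fixes H1 H2 :: "'a hypergraph"
  assumes "is_hypergraph H1" and "is_hypergraph H2"
    and "verts H1 \<inter> verts H2 = {}"
  shows "(outcome H1 = Out_A \<longrightarrow> outcome (hunion H1 H2) = outcome H2)
    \<and> (outcome H2 = Out_A \<longrightarrow> outcome (hunion H1 H2) = outcome H1)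
    \<and> (outcome H1 = Out_SL \<and> outcome H2 = Out_SL \<longrightarrow> outcome (hunion H1 H2) = Out_E)
    \<and> (outcome H1 = Out_E \<or> outcome H2 = Out_E \<longrightarrow> outcome (hunion H1 H2) = Out_E)"
proof -
  let ?w1 = "\<lambda>L. enf_wins (edges H1) L (verts H1) {}"
  let ?w2 = "\<lambda>L. enf_wins (edges H2) L (verts H2) {}"
  let ?w = "\<lambda>L. enf_wins (edges H1 \<union> edges H2) L (verts H1 \<union> verts H2) {}"
  have fin: "finite (verts H1)" "finite (verts H2)"
    using assms by (auto simp: is_hypergraph_def)
  have "\<Union>(edges H1) \<subseteq> verts H1" "\<Union>(edges H2) \<subseteq> verts H2"
    using assms by (auto simp: is_hypergraph_def)
  then have split: "split_position (verts H1) (verts H2) (edges H1) (edges H2)"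
    and split': "split_position (verts H2) (verts H1) (edges H2) (edges H1)"
    using fin assms(3) by (unfold_locales; blast)+
  have either: "?w L" if "?w1 L \<or> ?w2 L" for L
    using that enf_wins_union_left[OF fin] enf_wins_union_left[OF fin(2,1)]
    by (metis Un_commute)
  \<comment> \<open>\<open>\<not> ?w1 Avoider\<close> amounts to \<open>outcome H1 = Out_A\<close>;
    together with \<open>either\<close>, the union then has the values of \<open>H2\<close> for both
    choices of \<open>L\<close>.\<close>
  have "\<not> ?w L" if "\<not> ?w1 Avoider" "\<not> ?w2 L" for L
    using Avoider_wins_union[OF split] that by blast
  moreover have "\<not> ?w L" if "\<not> ?w2 Avoider" "\<not> ?w1 L" for L
    using Avoider_wins_union[OF split' that] by (simp add: Un_commute)
  moreover have "?w Enforcer" if "?w1 Avoider" "?w2 Avoider"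
    using enf_wins_union_SL[OF split that] .
  moreover have "?w1 Avoider" if "?w1 Enforcer"
    using enf_wins_second_to_last[OF fin(1) that] .
  moreover have "?w2 Avoider" if "?w2 Enforcer"
    using enf_wins_second_to_last[OF fin(2) that] .
  ultimately show ?thesis
    using either fin outcome_eq[of H1] outcome_eq[of H2] outcome_eq[of "hunion H1 H2"]
    by (auto simp: hunion_def split: if_splits)
qed

end
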